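(* Let $(\rho,f,R,p,g)$ be a cellular bisimulation between cellular automata $\gamma\colon X\to CX$ and $\delta\colon Y\to CY$, where $\rho\colon Q\to CQ$ and $f_1\colon\rho\to\gamma$, $f_2\colon\rho\to\delta$. Then for every $u\in Q$, the span $X^*\xleftarrow{p_1}R\xrightarrow{p_2}Y^*$ is a logical equivalence between $(\gamma,f_1(u))$ and $(\delta,f_2(u))$; that is, for all $r\in R$ and all modal formulas $\varphi$, $(\gamma,f_1(u),p_1(r))\models\varphi$ iff $(\delta,f_2(u),p_2(r))\models\varphi$.
   Context: Fix a monoid $(M,\cdot,e)$, a subset $N\subseteq M$ with inclusion $i\colon N\hookrightarrow M$, and a set $S$ of states. $[A,B]$ is the set of maps $A\to B$. For $a\colon M\to X$ let $I^a\subseteq[N,S]$ be the set of $f\colon N\to S$ with $f(n)=f(n')$ whenever $a(i(n))=a(i(n'))$; for $h\colon X\to Y$, $I^{h\circ a}\subseteq I^a$. Let $CX=\coprod_{a\colon M\to X}[I^a,S]$, $(Ch)(a,f)=(h\circ a, f|_{I^{h\circ a}})$. A cellular automaton is $\gamma\colon X\to CX$, $\gamma(x)=(\gamma_1(x),\gamma_2(x))$ with $\gamma_1(x)\colon M\to X$, $\gamma_2(x)\colon I^{\gamma_1(x)}\to S$, such that $\gamma_1(x)(e)=x$ and $\gamma_1(\gamma_1(x)(m))(n)=\gamma_1(x)(n\cdot m)$. A pre-cellular morphism $h\colon\gamma\to\delta$ is a map with $Ch\circ\gamma=\delta\circ h$. Configurations $X^*=[X,S]$; $h^*(c)=c\circ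 h$. Global rule $G_\gamma(c)(x)=\gamma_2(x)(c\circ\gamma_1(x)\circ i)$. A cellular bisimulation between $\gamma$ and $\delta$ is a tuple $(\rho,f,R,p,g)$: a cellular automaton $\rho\colon Q\to CQ$, pre-cellular morphisms $f_1\colon\rho\to\gamma$, $f_2\colon\rho\to\delta$, a set $R$ with maps $p_1\colon R\to X^*$, $p_2\colon R\to Y^*$, and $g\colon R\to R$, such that $f_1^*\circ p_1=f_2^*\circ p_2$, $p_1\circ g=G_\gamma\circ p_1$ and $p_2\circ g=G_\delta\circ p_2$. Modal formulas: $\varphi::=s\mid\neg\varphi\mid\bigvee_{j\in J}\varphi_j\mid\langle m\rangle\varphi\mid\bigcirc\varphi$ ($s\in S$, $m\in M$, $J$ arbitrary). Semantics: $(\gamma,x,c)\models s$ iff $c(x)=s$; $\neg,\bigvee$ classical; $(\gamma,x,c)\models\langle m\rangle\varphi$ iff $(\gamma,\gamma_1(x)(m),c)\models\varphi$; $(\gamma,x,c)\models\bigcirc\varphi$ iff $(\gamma,x,G_\gamma(c))\models\varphi$. A logical equivalence between based automata $(\gamma,x_0)$, $(\delta,y_0)$ is a span $X^*\xleftarrow{p_1}R\xrightarrow{p_2}Y^*$ with $(\gamma,x_0,p_1(r))\models\varphi\iff(\delta,y_0,p_2(r))\models\varphi$ for all $r\in R$ and formulas $\varphi$. *)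

theory Defs
  imports "HOL-Library.FuncSet"
begin

text \<open>
  The monoid is a type of class \<open>monoid_mult\<close>; the sets of states, of cells and of span elements
  are types. The neighbourhood \<open>N\<close> is a set \<open>N :: 'm set\<close>. Maps whose domain is not a full type
  are extensional functions: \<open>[N, S]\<close> is \<open>N \<rightarrow>\<^sub>E UNIV\<close>, and composing with
  the inclusion of \<open>N\<close> is restriction to \<open>N\<close>.
\<close>

text \<open>\<open>compat N a\<close> is the set \<open>I\<^sup>a \<subseteq> [N, S]\<close>.\<close>

definition compat :: "'m set \<Rightarrow> ('m \<Rightarrow> 'x) \<Rightarrow> ('m \<Rightarrow> 's) set" where
  "compat N a = {f \<in> N \<rightarrow>\<^sub>E UNIV. \<forall>n\<in>N. \<forall>n'\<in>N. a n = a n' \<longrightarrow> f n = f n'}"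

text \<open>The functor \<open>C\<close>: the coproduct over \<open>a\<close> of the sets \<open>[I\<^sup>a, S]\<close>, and its action on maps.\<close>

definition C_obj :: "'m set \<Rightarrow> (('m \<Rightarrow> 'x) \<times> (('m \<Rightarrow> 's) \<Rightarrow> 's)) set" where
  "C_obj N = (SIGMA a:UNIV. compat N a \<rightarrow>\<^sub>E UNIV)"

definition C_map :: "'m set \<Rightarrow> ('x \<Rightarrow> 'y) \<Rightarrow>
    ('m \<Rightarrow> 'x) \<times> (('m \<Rightarrow> 's) \<Rightarrow> 's) \<Rightarrow> ('m \<Rightarrow> 'y) \<times> (('m \<Rightarrow> 's) \<Rightarrow> 's)" where
  "C_map N h = (\<lambda>(a, f). (h \<circ> a, restrict f (compat N (h \<circ> a))))"

lemma compat_comp_subset: "compat N (h \<circ> a) \<subseteq> compat N a"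
proof
  fix f assume f: "f \<in> compat N (h \<circ> a)"
  have "f n = f n'" if "n \<in> N" "n' \<in> N" "a n = a n'" for n n'
  proof -
    have "(h \<circ> a) n = (h \<circ> a) n'" by (simp only: comp_apply that(3))
    then show ?thesis using f that(1,2) unfolding compat_def by blast
  qed
  then show "f \<in> compat N a" using f unfolding compat_def by blast
qed

lemma C_map_in_C_obj: "C_map N h z \<in> C_obj N"
  by (cases z) (simp add: C_obj_def C_map_def)

text \<open>
  A map \<open>\<gamma> : X \<rightarrow> C X\<close> is a function on \<open>'x\<close> with values in \<open>C_obj N\<close>; its components
  \<open>\<gamma>\<^sub>1 x\<close> and \<open>\<gamma>\<^sub>2 x\<close> are \<open>fst (\<gamma> x)\<close> and \<open>snd (\<gamma> x)\<close>.
\<close>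

type_synonym ('m, 's, 'x) coalg = "'x \<Rightarrow> ('m \<Rightarrow> 'x) \<times> (('m \<Rightarrow> 's) \<Rightarrow> 's)"

definition cellular_automaton ::
    "'m::monoid_mult set \<Rightarrow> ('m, 's, 'x) coalg \<Rightarrow> bool" where
  "cellular_automaton N \<gamma> \<longleftrightarrow>
     (\<forall>x. \<gamma> x \<in> C_obj N) \<and>
     (\<forall>x. fst (\<gamma> x) 1 = x) \<and>
     (\<forall>x m n. fst (\<gamma> (fst (\<gamma> x) m)) n = fst (\<gamma> x) (n * m))"

definition pre_cellular_morphism ::
    "'m set \<Rightarrow> ('m, 's, 'x) coalg \<Rightarrow> ('m, 's, 'y) coalg \<Rightarrow> ('x \<Rightarrow> 'y) \<Rightarrow> bool" where
  "pre_cellular_morphism N \<gamma> \<delta> h \<longleftrightarrow> C_map N h \<circ> \<gamma> = \<delta> \<circ> h"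

definition pullback :: "('x \<Rightarrow> 'y) \<Rightarrow> ('y \<Rightarrow> 's) \<Rightarrow> ('x \<Rightarrow> 's)" where
  "pullback h c = c \<circ> h"

definition global_rule ::
    "'m set \<Rightarrow> ('m, 's, 'x) coalg \<Rightarrow> ('x \<Rightarrow> 's) \<Rightarrow> ('x \<Rightarrow> 's)" where
  "global_rule N \<gamma> c x = snd (\<gamma> x) (restrict (c \<circ> fst (\<gamma> x)) N)"

lemma restrict_config_in_compat: "restrict (c \<circ> a) N \<in> compat N a"
  by (simp add: compat_def)

definition cellular_bisimulation ::
    "'m::monoid_mult set \<Rightarrow> ('m, 's, 'x) coalg \<Rightarrow> ('m, 's, 'y) coalg \<Rightarrow> ('m, 's, 'q) coalg \<Rightarrow>
     ('q \<Rightarrow> 'x) \<Rightarrow> ('q \<Rightarrow> 'y) \<Rightarrow> ('r \<Rightarrow> 'x \<Rightarrow> 's) \<Rightarrow> ('r \<Rightarrow> 'y \<Rightarrow> 's) \<Rightarrow> ('r \<Rightarrow> 'r) \<Rightarrow> bool" where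
  "cellular_bisimulation N \<gamma> \<delta> \<rho> f1 f2 p1 p2 g \<longleftrightarrow>
     cellular_automaton N \<rho> \<and>
     pre_cellular_morphism N \<rho> \<gamma> f1 \<and>
     pre_cellular_morphism N \<rho> \<delta> f2 \<and>
     pullback f1 \<circ> p1 = pullback f2 \<circ> p2 \<and>
     p1 \<circ> g = global_rule N \<gamma> \<circ> p1 \<and>
     p2 \<circ> g = global_rule N \<delta> \<circ> p2"

text \<open>
  A disjunction \<open>Disj J F\<close> is the disjunction of the \<open>F j\<close> with \<open>j \<in> J\<close>; the values of \<open>F\<close>
  outside \<open>J\<close> are irrelevant. Since index sets are arbitrary, formulas are parametrised by a type
  \<open>'j\<close> in which all index sets of a formula live; statements about all formulas are
  polymorphic in \<open>'j\<close>.
\<close>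

datatype ('s, 'm, 'j) formula =
    State 's
  | Neg "('s, 'm, 'j) formula"
  | Disj "'j set" "'j \<Rightarrow> ('s, 'm, 'j) formula"
  | Shift 'm "('s, 'm, 'j) formula"
  | Next "('s, 'm, 'j) formula"

primrec sat :: "'m set \<Rightarrow> ('m, 's, 'x) coalg \<Rightarrow> 'x \<Rightarrow> ('x \<Rightarrow> 's) \<Rightarrow> ('s, 'm, 'j) formula \<Rightarrow> bool" where
  "sat N \<gamma> x c (State s) \<longleftrightarrow> c x = s"
| "sat N \<gamma> x c (Neg \<phi>) \<longleftrightarrow> \<not> sat N \<gamma> x c \<phi>"
| "sat N \<gamma> x c (Disj J F) \<longleftrightarrow> (\<exists>j\<in>J. sat N \<gamma> x c (F j))"
| "sat N \<gamma> x c (Shift m \<phi>) \<longleftrightarrow> sat N \<gamma> (fst (\<gamma> x) m) c \<phi>"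
| "sat N \<gamma> x c (Next \<phi>) \<longleftrightarrow> sat N \<gamma> x (global_rule N \<gamma> c) \<phi>"

text \<open>The argument of type \<open>'j itself\<close> only fixes the index type of the formulas.\<close>

definition logical_equivalence ::
    "'j itself \<Rightarrow> 'm set \<Rightarrow> ('m, 's, 'x) coalg \<Rightarrow> 'x \<Rightarrow> ('m, 's, 'y) coalg \<Rightarrow> 'y \<Rightarrow>
     ('r \<Rightarrow> 'x \<Rightarrow> 's) \<Rightarrow> ('r \<Rightarrow> 'y \<Rightarrow> 's) \<Rightarrow> bool" where
  "logical_equivalence _ N \<gamma> x0 \<delta> y0 p1 p2 \<longleftrightarrow>
     (\<forall>r. \<forall>\<phi> :: ('s, 'm, 'j) formula. sat N \<gamma> x0 (p1 r) \<phi> \<longleftrightarrow> sat N \<delta> y0 (p2 r) \<phi>)"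

end

theory Submission imports Defs begin

text \<open>Induction on the formula, over all pairs \<open>(u, r)\<close> at once. The span
  condition on configurations settles atoms. A shift moves \<open>u\<close> inside
  \<open>\<rho>\<close>, because morphisms commute with translations
  (\<open>pre_cellular_morphism_fst\<close>); a time step moves \<open>r\<close> to
  \<open>g r\<close>, because \<open>p1\<close> and \<open>p2\<close> intertwine \<open>g\<close>
  with the global rules.\<close>

text \<open>Comparison of first components in the coalgebra square: there \<open>C_map N h\<close>
  is postcomposition with \<open>h\<close>.\<close>

lemma pre_cellular_morphism_fst:
  assumes "pre_cellular_morphism N \<rho> \<gamma> h"
  shows "fst (\<gamma> (h u)) m = h (fst (\<rho> u) m)"
proof -
  have "\<gamma> (h u) = C_map N h (\<rho> u)"
    using assms unfolding pre_cellular_morphism_def by (metis comp_apply)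
  then show ?thesis
    by (simp add: C_map_def split_beta)
qed

lemma cellular_bisimulation_sat_iff:
  assumes "cellular_bisimulation N \<gamma> \<delta> \<rho> f1 f2 p1 p2 g"
  shows "sat N \<gamma> (f1 u) (p1 r) \<phi> \<longleftrightarrow> sat N \<delta> (f2 u) (p2 r) \<phi>"
\<comment> \<open>Both are generalised: \<open>Shift\<close> changes \<open>u\<close> and
  \<open>Next\<close> changes \<open>r\<close>.\<close>
proof (induction \<phi> arbitrary: u r)
  case (State s)
  have "pullback f1 (p1 r) = pullback f2 (p2 r)"
    using assms unfolding cellular_bisimulation_def by (metis comp_apply)
  then have "p1 r (f1 u) = p2 r (f2 u)"
    unfolding pullback_def by (metis comp_apply)
  then show ?case by simp
next
  case (Shift m \<phi>)
  \<comment> \<open>Both shifted cells are images of one cell of \<open>\<rho>\<close>, the new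
    \<open>u\<close>.\<close>
  have "fst (\<gamma> (f1 u)) m = f1 (fst (\<rho> u) m)" "fst (\<delta> (f2 u)) m = f2 (fst (\<rho> u) m)"
    using assms by (auto simp: cellular_bisimulation_def intro!: pre_cellular_morphism_fst)
  then show ?case using Shift.IH by simp
next
  case (Next \<phi>)
  \<comment> \<open>Both updated configurations come from the one element \<open>g r\<close>, the
    new \<open>r\<close>.\<close>
  have "global_rule N \<gamma> (p1 r) = p1 (g r)" "global_rule N \<delta> (p2 r) = p2 (g r)"
    using assms unfolding cellular_bisimulation_def by (metis comp_apply)+
  then show ?case using Next.IH by simp
qed auto

theorem theorem2:
  fixes N :: "'m::monoid_mult set"
    and \<gamma> :: "('m, 's, 'x) coalg" and \<delta> :: "('m, 's, 'y) coalg" and \<rho> :: "('m, 's, 'q) coalg"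
    and f1 :: "'q \<Rightarrow> 'x" and f2 :: "'q \<Rightarrow> 'y"
    and p1 :: "'r \<Rightarrow> 'x \<Rightarrow> 's" and p2 :: "'r \<Rightarrow> 'y \<Rightarrow> 's" and g :: "'r \<Rightarrow> 'r"
    and u :: 'q
  assumes "cellular_automaton N \<gamma>" and "cellular_automaton N \<delta>"
    and "cellular_bisimulation N \<gamma> \<delta> \<rho> f1 f2 p1 p2 g"
  shows "logical_equivalence TYPE('j) N \<gamma> (f1 u) \<delta> (f2 u) p1 p2"
  unfolding logical_equivalence_def
  by (intro allI cellular_bisimulation_sat_iff[OF assms(3)])

end
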